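(* Let $P$ be a set of pairwise non-attacking rooks in $\{1,\dots,n\}^3$, let $I,J,K\subseteq N=\{1,\dots,n\}$ with $|I|=a,|J|=b,|K|=c$, $T_0=I\times J\times K$, $T_3=I^c\times J^c\times K^c$, let $c_0,c_3$ be the numbers of rooks of $P$ in $T_0,T_3$, $\operatorname{def}(T_0,T_3)=n^2-(a+b+c)n+ab+bc+ca-c_0-c_3$ and $\operatorname{def}(H)=n^2-|P|$. Then $$\operatorname{def}(T_0,T_3)=\operatorname{def}(H)-E_y(I^c\times N\times K)-E_z(I\times J^c\times N)-E_x(N\times J\times K^c).$$
   Context: Two rooks are non-attacking if they agree in at most one coordinate. A file of direction $x$ is $\{(t,j,k):t\in N\}$ for fixed $(j,k)$, similarly for $y,z$. For a brick $X$ with full range $N$ in direction $x$, $E_x(X)$ is the number of $x$-directional files in $X$ containing no rook of $P$; $E_y,E_z$ analogously. In the paper's notation the three bricks are $T_{1a}\cup T_{2ab}$, $T_{1b}\cup T_{2bc}$, $T_{1c}\cup T_{2ac}$ with $T_{1a}=I^c\times J\times K$, $T_{2ab}=I^c\times J^c\times K$, $T_{1b}=I\times J^c\times K$, $T_{2bc}=I\times J^c\times K^c$, $T_{1c}=I\times J\times K^c$, $T_{2ac}=I^c\times J\times K^c$. *)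

theory Defs
  imports Main
begin

type_synonym cell = "nat \<times> nat \<times> nat"

abbreviation N :: "nat \<Rightarrow> nat set"
  where "N n \<equiv> {1..n}"

abbreviation cube :: "nat \<Rightarrow> cell set"
  where "cube n \<equiv> N n \<times> N n \<times> N n"

fun agreements :: "cell \<Rightarrow> cell \<Rightarrow> nat"
  where "agreements (x, y, z) (x', y', z') = of_bool (x = x') + of_bool (y = y') + of_bool (z = z')"

definition non_attacking :: "cell \<Rightarrow> cell \<Rightarrow> bool"
  where "non_attacking p q \<longleftrightarrow> agreements p q \<le> 1"

text \<open>Files are sets of cells of the cube; the two arguments are the fixed coordinates, in the
  order in which they occur in a cell.\<close>

definition file_x :: "nat \<Rightarrow> nat \<Rightarrow> nat \<Rightarrow> cell set"
  where "file_x n j k = {(t, j, k) | t. t \<in> N n}"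

definition file_y :: "nat \<Rightarrow> nat \<Rightarrow> nat \<Rightarrow> cell set"
  where "file_y n i k = {(i, t, k) | t. t \<in> N n}"

definition file_z :: "nat \<Rightarrow> nat \<Rightarrow> nat \<Rightarrow> cell set"
  where "file_z n i j = {(i, j, t) | t. t \<in> N n}"

definition files_x :: "nat \<Rightarrow> cell set set"
  where "files_x n = {file_x n j k | j k. j \<in> N n \<and> k \<in> N n}"

definition files_y :: "nat \<Rightarrow> cell set set"
  where "files_y n = {file_y n i k | i k. i \<in> N n \<and> k \<in> N n}"

definition files_z :: "nat \<Rightarrow> cell set set"
  where "files_z n = {file_z n i j | i j. i \<in> N n \<and> j \<in> N n}"

text \<open>These are meant for bricks \<open>X\<close> that have full range in the direction concerned, so that
  \<open>X\<close> is a union of files of that direction.\<close>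

definition E_x :: "nat \<Rightarrow> cell set \<Rightarrow> cell set \<Rightarrow> nat"
  where "E_x n P X = card {F \<in> files_x n. F \<subseteq> X \<and> F \<inter> P = {}}"

definition E_y :: "nat \<Rightarrow> cell set \<Rightarrow> cell set \<Rightarrow> nat"
  where "E_y n P X = card {F \<in> files_y n. F \<subseteq> X \<and> F \<inter> P = {}}"

definition E_z :: "nat \<Rightarrow> cell set \<Rightarrow> cell set \<Rightarrow> nat"
  where "E_z n P X = card {F \<in> files_z n. F \<subseteq> X \<and> F \<inter> P = {}}"

definition T0 :: "nat set \<Rightarrow> nat set \<Rightarrow> nat set \<Rightarrow> cell set"
  where "T0 I J K = I \<times> J \<times> K"

definition T3 :: "nat \<Rightarrow> nat set \<Rightarrow> nat set \<Rightarrow> nat set \<Rightarrow> cell set"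
  where "T3 n I J K = (N n - I) \<times> (N n - J) \<times> (N n - K)"

text \<open>Deficiencies are integer-valued: the defining differences must not be truncated. The pair
  \<open>(T\<^sub>0, T\<^sub>3)\<close> is given by the index sets \<open>I, J, K\<close>, from which its dimensions are read off.\<close>

definition def_pair :: "nat \<Rightarrow> cell set \<Rightarrow> nat set \<Rightarrow> nat set \<Rightarrow> nat set \<Rightarrow> int"
  where "def_pair n P I J K =
    (let a = int (card I); b = int (card J); c = int (card K);
         c0 = int (card (P \<inter> T0 I J K)); c3 = int (card (P \<inter> T3 n I J K))
     in (int n)^2 - (a + b + c) * int n + a * b + b * c + c * a - c0 - c3)"

definition def_H :: "nat \<Rightarrow> cell set \<Rightarrow> int"
  where "def_H n P = (int n)^2 - int (card P)"

end

theory Submission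
  imports Defs
begin

text \<open>Two non-attacking rooks never share a file, so a brick that is a union of \<open>m\<close> parallel files
  contains exactly \<open>m\<close> minus its number of empty files rooks. The three bricks together with
  \<open>T\<^sub>0\<close> and \<open>T\<^sub>3\<close> partition the cube, and the numbers of files of the bricks add up to
  \<open>(a + b + c) n - (ab + bc + ca)\<close>.\<close>

lemma card_empty_fibres:
  assumes "finite A" and "inj_on f A"
    and "inj_on g (P \<inter> X)" and "g ` (P \<inter> X) \<subseteq> A"
    and f: "\<And>i p. i \<in> A \<Longrightarrow> p \<in> P \<Longrightarrow> p \<in> f i \<longleftrightarrow> p \<in> X \<and> g p = i"
  shows "int (card {F \<in> f ` A. F \<inter> P = {}}) = int (card A) - int (card (P \<inter> X))"
proof -
  have "f i \<inter> P = {} \<longleftrightarrow> i \<notin> g ` (P \<inter> X)" if "i \<in> A" for i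
    using f[OF that] by blast
  then have "{F \<in> f ` A. F \<inter> P = {}} = f ` (A - g ` (P \<inter> X))"
    by blast
  then have "card {F \<in> f ` A. F \<inter> P = {}} = card (A - g ` (P \<inter> X))"
    using \<open>inj_on f A\<close> by (simp add: card_image inj_on_diff)
  also have "\<dots> = card A - card (P \<inter> X)"
    using assms by (simp add: card_Diff_subset finite_subset card_image)
  \<comment> \<open>The difference of naturals is exact, because \<open>g\<close> embeds the rooks
    of \<open>X\<close> into \<open>A\<close>.\<close>
  finally show ?thesis
    using card_mono[OF assms(1,4)] card_image[OF assms(3)] by (simp add: of_nat_diff)
qed

lemma mem_files [simp]:
  "(x, y, z) \<in> file_x n j k \<longleftrightarrow> x \<in> N n \<and> y = j \<and> z = k"
  "(x, y, z) \<in> file_y n i k \<longleftrightarrow> y \<in> N n \<and> x = i \<and> z = k"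
  "(x, y, z) \<in> file_z n i j \<longleftrightarrow> z \<in> N n \<and> x = i \<and> y = j"
  by (auto simp: file_x_def file_y_def file_z_def)

text \<open>The cell of a file with free coordinate 1 forces the fixed coordinates into the brick.
  For \<open>n = 0\<close> there is no such cell: every file is empty and lies in every
  brick.\<close>

lemma file_subset_brick_iff:
  assumes "0 < n"
  shows "file_x n j k \<subseteq> N n \<times> B \<times> C \<longleftrightarrow> j \<in> B \<and> k \<in> C"
    and "file_y n i k \<subseteq> A \<times> N n \<times> C \<longleftrightarrow> i \<in> A \<and> k \<in> C"
    and "file_z n i j \<subseteq> A \<times> B \<times> N n \<longleftrightarrow> i \<in> A \<and> j \<in> B"
proof -
  have "1 \<in> N n"
    using assms by simp
  then show "file_x n j k \<subseteq> N n \<times> B \<times> C \<longleftrightarrow> j \<in> B \<and> k \<in> C"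
    and "file_y n i k \<subseteq> A \<times> N n \<times> C \<longleftrightarrow> i \<in> A \<and> k \<in> C"
    and "file_z n i j \<subseteq> A \<times> B \<times> N n \<longleftrightarrow> i \<in> A \<and> j \<in> B"
    unfolding file_x_def file_y_def file_z_def by blast+
qed

lemma file_eq_iff:
  assumes "0 < n"
  shows "file_x n j k = file_x n j' k' \<longleftrightarrow> j = j' \<and> k = k'"
    and "file_y n i k = file_y n i' k' \<longleftrightarrow> i = i' \<and> k = k'"
    and "file_z n i j = file_z n i' j' \<longleftrightarrow> i = i' \<and> j = j'"
proof -
  \<comment> \<open>A file is told apart from the others of its direction by any one of its
    cells.\<close>
  have "(1, j, k) \<in> file_x n j k" "(i, 1, k) \<in> file_y n i k" "(i, j, 1) \<in> file_z n i j"
    using assms by auto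
  then show "file_x n j k = file_x n j' k' \<longleftrightarrow> j = j' \<and> k = k'"
    and "file_y n i k = file_y n i' k' \<longleftrightarrow> i = i' \<and> k = k'"
    and "file_z n i j = file_z n i' j' \<longleftrightarrow> i = i' \<and> j = j'"
    by (metis mem_files(1), metis mem_files(2), metis mem_files(3))
qed

locale rooks =
  fixes n :: nat and P :: "cell set"
  assumes in_cube: "P \<subseteq> cube n"
    and non_attacking: "\<forall>p\<in>P. \<forall>q\<in>P. p \<noteq> q \<longrightarrow> non_attacking p q"
begin

text \<open>Meant for a projection \<open>g\<close> that forgets one coordinate: distinct cells with
  the same image agree in the other two coordinates, so they attack each other.\<close>

lemma inj_on_rooks:
  assumes "\<And>p q. g p = g q \<Longrightarrow> p \<noteq> q \<Longrightarrow> \<not> non_attacking p q"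
  shows "inj_on g (P \<inter> X)"
  using assms non_attacking unfolding inj_on_def by blast

lemma E_x_brick:
  assumes "B \<subseteq> N n" and "C \<subseteq> N n"
  shows "int (E_x n P (N n \<times> B \<times> C)) = int (card B) * int (card C) - int (card (P \<inter> N n \<times> B \<times> C))"
proof (cases "n = 0")
  \<comment> \<open>Here \<open>B\<close> and \<open>C\<close> are empty and
    \<open>files_x n\<close> has no members, so both sides are 0.\<close>
  case True
  then show ?thesis
    using assms by (simp add: E_x_def files_x_def)
next
  case False
  then have pos: "0 < n"
    by simp
  let ?X = "N n \<times> B \<times> C" and ?f = "\<lambda>(j, k). file_x n j k"
  \<comment> \<open>The files inside the brick are those indexed by \<open>B \<times> C\<close>. The
    set \<open>N n\<close> is kept in the form \<open>{1..n}\<close>, in which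
    \<open>file_subset_brick_iff\<close> applies.\<close>
  have "{F \<in> files_x n. F \<subseteq> ?X \<and> F \<inter> P = {}} = {F \<in> ?f ` (B \<times> C). F \<inter> P = {}}"
    using assms
    by (auto simp: files_x_def image_iff file_subset_brick_iff[OF pos] file_eq_iff[OF pos]
        simp del: atLeastAtMost_iff One_nat_def)
  moreover have "int (card {F \<in> ?f ` (B \<times> C). F \<inter> P = {}})
      = int (card (B \<times> C)) - int (card (P \<inter> ?X))"
  \<comment> \<open>Cells are nested pairs, so \<open>snd\<close> forgets exactly the
    x-coordinate.\<close>
  proof (rule card_empty_fibres[where g = snd])
    show "finite (B \<times> C)"
      using assms by (auto intro: finite_subset)
    show "inj_on ?f (B \<times> C)"
      by (auto simp: inj_on_def file_eq_iff[OF pos])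
    show "inj_on snd (P \<inter> ?X)"
      by (rule inj_on_rooks) (auto simp: non_attacking_def)
  qed (use in_cube in \<open>auto simp: file_x_def\<close>)
  ultimately show ?thesis
    by (simp add: E_x_def card_cartesian_product)
qed

lemma E_y_brick:
  assumes "A \<subseteq> N n" and "C \<subseteq> N n"
  shows "int (E_y n P (A \<times> N n \<times> C)) = int (card A) * int (card C) - int (card (P \<inter> A \<times> N n \<times> C))"
proof (cases "n = 0")
  case True
  then show ?thesis
    using assms by (simp add: E_y_def files_y_def)
next
  case False
  then have pos: "0 < n"
    by simp
  let ?X = "A \<times> N n \<times> C" and ?f = "\<lambda>(i, k). file_y n i k"
  have "{F \<in> files_y n. F \<subseteq> ?X \<and> F \<inter> P = {}} = {F \<in> ?f ` (A \<times> C). F \<inter> P = {}}"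
    using assms
    by (auto simp: files_y_def image_iff file_subset_brick_iff[OF pos] file_eq_iff[OF pos]
        simp del: atLeastAtMost_iff One_nat_def)
  moreover have "int (card {F \<in> ?f ` (A \<times> C). F \<inter> P = {}})
      = int (card (A \<times> C)) - int (card (P \<inter> ?X))"
  \<comment> \<open>The projection along the y-direction, with values in the index set of the
    y-files.\<close>
  proof (rule card_empty_fibres[where g = "\<lambda>(x, y, z). (x, z)"])
    show "finite (A \<times> C)"
      using assms by (auto intro: finite_subset)
    show "inj_on ?f (A \<times> C)"
      by (auto simp: inj_on_def file_eq_iff[OF pos])
    show "inj_on (\<lambda>(x, y, z). (x, z)) (P \<inter> ?X)"
      by (rule inj_on_rooks) (auto simp: non_attacking_def)
  qed (use in_cube in \<open>auto simp: file_y_def\<close>)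
  ultimately show ?thesis
    by (simp add: E_y_def card_cartesian_product)
qed

lemma E_z_brick:
  assumes "A \<subseteq> N n" and "B \<subseteq> N n"
  shows "int (E_z n P (A \<times> B \<times> N n)) = int (card A) * int (card B) - int (card (P \<inter> A \<times> B \<times> N n))"
proof (cases "n = 0")
  case True
  then show ?thesis
    using assms by (simp add: E_z_def files_z_def)
next
  case False
  then have pos: "0 < n"
    by simp
  let ?X = "A \<times> B \<times> N n" and ?f = "\<lambda>(i, j). file_z n i j"
  have "{F \<in> files_z n. F \<subseteq> ?X \<and> F \<inter> P = {}} = {F \<in> ?f ` (A \<times> B). F \<inter> P = {}}"
    using assms
    by (auto simp: files_z_def image_iff file_subset_brick_iff[OF pos] file_eq_iff[OF pos]
        simp del: atLeastAtMost_iff One_nat_def)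
  moreover have "int (card {F \<in> ?f ` (A \<times> B). F \<inter> P = {}})
      = int (card (A \<times> B)) - int (card (P \<inter> ?X))"
  proof (rule card_empty_fibres[where g = "\<lambda>(x, y, z). (x, y)"])
    show "finite (A \<times> B)"
      using assms by (auto intro: finite_subset)
    show "inj_on ?f (A \<times> B)"
      by (auto simp: inj_on_def file_eq_iff[OF pos])
    show "inj_on (\<lambda>(x, y, z). (x, y)) (P \<inter> ?X)"
      by (rule inj_on_rooks) (auto simp: non_attacking_def)
  qed (use in_cube in \<open>auto simp: file_z_def\<close>)
  ultimately show ?thesis
    by (simp add: E_z_def card_cartesian_product)
qed

text \<open>Read the conditions x in \<open>I\<close>, y in \<open>J\<close>, z in \<open>K\<close>
  as three truth values on a cycle. If all are equal, the cell is in \<open>T0\<close> or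
  \<open>T3\<close>. Otherwise exactly one cyclic step goes from true to false: I to J, J to K or K
  to I, and each of these is one brick with its third coordinate free.\<close>

lemma card_rooks:
  assumes "I \<subseteq> N n" and "J \<subseteq> N n" and "K \<subseteq> N n"
  shows "card P = card (P \<inter> T0 I J K) + card (P \<inter> T3 n I J K)
    + card (P \<inter> (N n - I) \<times> N n \<times> K) + card (P \<inter> I \<times> (N n - J) \<times> N n)
    + card (P \<inter> N n \<times> J \<times> (N n - K))"
    (is "_ = card ?A + card ?B + card ?C + card ?D + card ?E")
proof -
  have "finite P"
    by (rule finite_subset[OF in_cube]) simp
  have "P = ?A \<union> ?B \<union> ?C \<union> ?D \<union> ?E"
    using in_cube assms unfolding T0_def T3_def by blast
  then have "card P = card (?A \<union> ?B \<union> ?C \<union> ?D \<union> ?E)"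
    by (rule arg_cong)
  also have "\<dots> = card (?A \<union> ?B \<union> ?C \<union> ?D) + card ?E"
    by (rule card_Un_disjoint) (use \<open>finite P\<close> in \<open>auto simp: T0_def T3_def\<close>)
  also have "card (?A \<union> ?B \<union> ?C \<union> ?D) = card (?A \<union> ?B \<union> ?C) + card ?D"
    by (rule card_Un_disjoint) (use \<open>finite P\<close> in \<open>auto simp: T0_def T3_def\<close>)
  also have "card (?A \<union> ?B \<union> ?C) = card (?A \<union> ?B) + card ?C"
    by (rule card_Un_disjoint) (use \<open>finite P\<close> in \<open>auto simp: T0_def T3_def\<close>)
  also have "card (?A \<union> ?B) = card ?A + card ?B"
    by (rule card_Un_disjoint) (use \<open>finite P\<close> in \<open>auto simp: T0_def T3_def\<close>)
  finally show ?thesis .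
qed

end

theorem theorem6p8:
  fixes n :: nat and P :: "cell set" and I J K :: "nat set"
  assumes "P \<subseteq> cube n"
    and "\<forall>p\<in>P. \<forall>q\<in>P. p \<noteq> q \<longrightarrow> non_attacking p q"
    and "I \<subseteq> N n" and "J \<subseteq> N n" and "K \<subseteq> N n"
  shows "def_pair n P I J K =
    def_H n P
      - int (E_y n P ((N n - I) \<times> N n \<times> K))
      - int (E_z n P (I \<times> (N n - J) \<times> N n))
      - int (E_x n P (N n \<times> J \<times> (N n - K)))"
proof -
  interpret rooks n P
    using assms(1,2) by unfold_locales
  have card_compl: "int (card (N n - S)) = int n - int (card S)" if "S \<subseteq> N n" for S
    using that card_mono[OF _ that] by (simp add: card_Diff_subset finite_subset)
  show ?thesis
    \<comment> \<open>The rooks in the three bricks cancel against their share of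
      \<open>card P\<close>, which leaves \<open>c0\<close> and \<open>c3\<close>. The file counts
      satisfy (n - a)c + a(n - b) + b(n - c) = (a + b + c)n - (ab + bc + ca).\<close>
    unfolding def_pair_def def_H_def Let_def card_rooks[OF assms(3-5)]
      E_x_brick[OF assms(4) Diff_subset] E_y_brick[OF Diff_subset assms(5)]
      E_z_brick[OF assms(3) Diff_subset]
      card_compl[OF assms(3)] card_compl[OF assms(4)] card_compl[OF assms(5)]
    by (simp add: algebra_simps)
qed

end
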